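(* For all integers $\alpha\ge0$ and $n\ge0$, \begin{align*} b_{5}\!\left(4\cdot5^{2\alpha+1}n+\tfrac{31\cdot 5^{2\alpha}-1}{6}\right)&\equiv 0\pmod 2,\\ b_{5}\!\left(4\cdot5^{2\alpha+1}n+\tfrac{79\cdot 5^{2\alpha}-1}{6}\right)&\equiv 0\pmod 2,\\ b_{5}\!\left(4\cdot5^{2\alpha+2}n+\tfrac{83\cdot 5^{2\alpha+1}-1}{6}\right)&\equiv 0\pmod 2,\\ b_{5}\!\left(4\cdot5^{2\alpha+2}n+\tfrac{107\cdot 5^{2\alpha+1}-1}{6}\right)&\equiv 0\pmod 2. \end{align*}
   Context: For a positive integer $\ell$, $b_\ell(n)$ denotes the number of partitions of $n$ having no part divisible by $\ell$. *)

theory Defs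
  imports Main "HOL-Library.Multiset"
begin

definition partitions :: "nat \<Rightarrow> nat multiset set" where
  "partitions n = {p. (\<forall>x\<in>#p. 0 < x) \<and> sum_mset p = n}"

definition b :: "nat \<Rightarrow> nat \<Rightarrow> nat" where
  "b l n = card {p \<in> partitions n. \<forall>x\<in>#p. \<not> l dvd x}"

end

theory Submission
  imports Defs "HOL-Library.Z2" "HOL-Library.Disjoint_Sets" "HOL-Computational_Algebra.Formal_Power_Series"
begin

text \<open>
  Work with power series over the field with two elements. Put \<open>E = \<Prod>(1 - q\<^sup>i)\<close>, so that
  \<open>B = \<Sum> b\<^sub>5(n) q\<^sup>n\<close> satisfies \<open>B E = F\<close> with \<open>F = E(q\<^sup>5)\<close>. By Euler's pentagonal number theorem the
  coefficient of \<open>q\<^sup>n\<close> in \<open>E\<close> is 1 exactly if \<open>24n + 1\<close> is a square, so products of such series count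
  representations by diagonal binary quadratic forms. Multiplication by \<open>1 + \<surd>-d\<close> (\<open>d = 2, 5\<close>) relates
  the solutions of \<open>x\<^sup>2 + d y\<^sup>2 = (d + 1) m\<close> to those of \<open>u\<^sup>2 + d v\<^sup>2 = m\<close>, whose parity is read off from
  sign changes; this gives \<open>E F = E\<^sup>6 + q F\<^sup>6\<close>, hence \<open>B = E\<^sup>4 + q F\<^sup>4 B\<^sup>2\<close>. Since squaring is the
  substitution \<open>q \<mapsto> q\<^sup>2\<close>, extracting coefficients twice shows that \<open>b\<^sub>5(4m + 1)\<close> is congruent
  modulo 2 to the number of solutions of \<open>2x\<^sup>2 + 5y\<^sup>2 = 24m + 7\<close> with \<open>x, y > 0\<close> prime to 6. For the four
  progressions there are none, by descent at 5.
\<close>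

unbundle fps_syntax

text \<open>These rules replace \<open>+\<close> and \<open>*\<close> by bit operations, which disables the ring simplification rules.\<close>
declare add_bit_eq_xor [simp del] mult_bit_eq_and [simp del]

subsection \<open>The pentagonal number theorem modulo 2\<close>

text \<open>
  Shanks' finite form of the pentagonal number theorem: passing from \<open>n\<close> to \<open>n + 1\<close>, the differences
  of corresponding summands telescope. All summands with \<open>s > 0\<close> vanish modulo \<open>q\<^bsup>n+1\<^esup>\<close>.
\<close>
lemma finite_pentagonal:
  fixes q :: "'a::comm_ring_1"
  shows "(\<Sum>s\<le>n. (-1)^s * (\<Prod>i\<in>{s<..n}. 1 - q^i) * q^(s*n + s*(s+1) div 2)) =
         1 + (\<Sum>k=1..n. (-1)^k * (q^(k*(3*k-1) div 2) + q^(k*(3*k+1) div 2)))"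
proof (induction n)
  case 0
  show ?case by simp
next
  case (Suc n)
  define Q where "Q s m = (\<Prod>i\<in>{s<..m}. 1 - q^i)" for s m
  define T where "T s = s*(s+1) div 2" for s :: nat
  \<comment> \<open>\<open>- g s\<close> is the contribution of \<open>- q^Suc n\<close> from
    \<open>Q_Suc\<close> to the new summand. By \<open>Q_pred\<close> the rest of the difference is
    \<open>g (s - 1)\<close>, or zero for \<open>s = 0\<close>; so the differences
    telescope.\<close>
  define g where "g s = (-1)^s * Q s n * q^((s+1) * Suc n + T s)" for s
  define h where "h k = (-1)^k * (q^(k*(3*k-1) div 2) + q^(k*(3*k+1) div 2))" for k
  have T_Suc: "T (Suc s) = Suc s + T s" for s
    by (simp add: T_def)
  have Q_Suc: "Q s (Suc n) = Q s n * (1 - q^Suc n)" if "s \<le> n" for s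
  proof -
    have "{s<..Suc n} = insert (Suc n) {s<..n}"
      using that by auto
    then show ?thesis
      by (simp add: Q_def mult.commute)
  qed
  have Q_pred: "Q s n = Q (Suc s) n * (1 - q^Suc s)" if "s < n" for s
  proof -
    have "{s<..n} = insert (Suc s) {Suc s<..n}"
      using that by auto
    then show ?thesis
      by (simp add: Q_def mult.commute)
  qed
  have telescope: "(\<Sum>s\<le>k. (-1)^s * Q s (Suc n) * q^(s*Suc n + T s) - (-1)^s * Q s n * q^(s*n + T s)) = - g k"
    if "k \<le> n" for k
    using that
  proof (induction k)
    case 0
    then show ?case
      by (simp add: g_def Q_Suc algebra_simps T_def)
  next
    case (Suc k)
    have e1: "(-1)^Suc k * Q (Suc k) (Suc n) * q^(Suc k*Suc n + T (Suc k))
          = (-1)^Suc k * Q (Suc k) n * q^(Suc k*Suc n + T (Suc k)) + - g (Suc k)"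
      unfolding g_def Q_Suc[OF Suc.prems] by (simp add: algebra_simps power_add)
    have "g k = (-1)^k * Q (Suc k) n * (1 - q^Suc k) * q^(Suc k*n + T (Suc k))"
      using Suc.prems unfolding g_def by (subst Q_pred) (simp_all add: T_Suc algebra_simps)
    also have "\<dots> = (-1)^Suc k * Q (Suc k) n * q^(Suc k*Suc n + T (Suc k))
        - (-1)^Suc k * Q (Suc k) n * q^(Suc k*n + T (Suc k))"
      by (simp add: algebra_simps power_add)
    finally show ?case
      using Suc e1 by (simp del: power_Suc)
  qed
  let ?S = "\<lambda>n. \<Sum>s\<le>n. (-1)^s * Q s n * q^(s*n + T s)"
  have Qnn: "Q m m = 1" for m
    by (simp add: Q_def)
  have "?S (Suc n) = (\<Sum>s\<le>n. (-1)^s * Q s (Suc n) * q^(s*Suc n + T s)) + (-1)^Suc n * q^(Suc n*Suc n + T (Suc n))"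
    by (simp add: Qnn)
  also have "\<dots> = ?S n - g n + (-1)^Suc n * q^(Suc n*Suc n + T (Suc n))"
    using telescope[of n] by (simp add: sum_subtractf algebra_simps)
  \<comment> \<open>The telescoping remainder and the extra summand \<open>s = Suc n\<close> supply
    the two new pentagonal powers.\<close>
  also have "\<dots> = ?S n + (-1)^Suc n * (q^(Suc n*Suc n + T n) + q^(Suc n*Suc n + T (Suc n)))"
    by (simp add: g_def Qnn algebra_simps)
  also have "Suc n*Suc n + T n = Suc n * (3 * Suc n - 1) div 2"
  proof -
    have "Suc n*Suc n + T n = (2*(Suc n*Suc n) + n * (n + 1)) div 2"
      by (simp add: T_def)
    also have "2*(Suc n*Suc n) + n * (n + 1) = Suc n * (3 * Suc n - 1)"
      by (simp add: algebra_simps)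
    finally show ?thesis .
  qed
  also have "Suc n*Suc n + T (Suc n) = Suc n * (3 * Suc n + 1) div 2"
  proof -
    have "Suc n*Suc n + T (Suc n) = (2*(Suc n*Suc n) + Suc n * (Suc n + 1)) div 2"
      by (simp add: T_def del: mult_Suc mult_Suc_right)
    also have "2*(Suc n*Suc n) + Suc n * (Suc n + 1) = Suc n * (3 * Suc n + 1)"
      by (simp add: algebra_simps)
    finally show ?thesis .
  qed
  finally have step: "?S (Suc n) = ?S n + h (Suc n)"
    unfolding h_def .
  have "(\<Sum>k=1..Suc n. h k) = (\<Sum>k=1..n. h k) + h (Suc n)"
    by simp
  then have "?S (Suc n) = 1 + (\<Sum>k=1..Suc n. h k)"
    using step Suc.IH unfolding Q_def T_def h_def by (simp only: add.assoc)
  then show ?case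
    unfolding Q_def T_def h_def .
qed

text \<open>For \<open>q = fps_X\<close>, only the summand \<open>s = 0\<close>, which is the full
  product, has terms of degree at most \<open>n\<close>.\<close>

lemma prod_one_minus_X_power_nth:
  assumes "m \<le> n"
  shows "(\<Prod>i=1..n. 1 - fps_X^i :: 'a::comm_ring_1 fps) $ m =
    (1 + (\<Sum>k=1..n. (-1)^k * (fps_X^(k*(3*k-1) div 2) + fps_X^(k*(3*k+1) div 2)))) $ m"
proof -
  let ?t = "\<lambda>s. (-1)^s * (\<Prod>i\<in>{s<..n}. 1 - fps_X^i) * fps_X^(s*n + s*(s+1) div 2) :: 'a fps"
  have "?t s $ m = 0" if "s \<in> {..n} - {0}" for s
  proof -
    have "s * (s + 1) div 2 > 0" "s * n \<ge> n"
      using that by (cases s; force)+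
    then have "m < s*n + s*(s+1) div 2"
      using assms by linarith
    then show ?thesis
      by (simp only: fps_X_power_mult_right_nth if_True)
  qed
  then have "(\<Sum>s\<le>n. ?t s) $ m = (\<Sum>s\<in>{0}. ?t s $ m)"
    unfolding fps_sum_nth by (intro sum.mono_neutral_right) auto
  then show ?thesis
    unfolding finite_pentagonal by (simp add: atLeastSucAtMost_greaterThanAtMost)
qed

text \<open>This is \<open>E\<close> modulo 2, given by its support, the pentagonal numbers. The
  criterion by squares avoids infinite products and lets products of such series count solutions of
  quadratic equations.\<close>

definition euler_mod2 :: "bit fps" where
  "euler_mod2 = Abs_fps (\<lambda>n. of_bool (\<exists>x. x^2 = 24*n + 1))"

lemma square_eq_24_mult_plus_1_imp_mod_6:
  fixes x :: nat
  assumes "x^2 = 24 * n + 1"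
  shows "x mod 6 = 1 \<or> x mod 6 = 5"
proof -
  have "x^2 mod 6 = (24 * n + 1) mod 6"
    by (simp add: assms)
  also have "\<dots> = 1"
    by presburger
  finally have "(x mod 6)^2 mod 6 = 1"
    by (simp add: power_mod)
  moreover have "x mod 6 \<in> {0,1,2,3,4,5}"
    by auto
  ultimately show ?thesis
    by auto
qed

text \<open>Complete the square: 12k(3k - 1) + 1 = (6k - 1)^2, and likewise with plus signs.\<close>

lemma pentagonal_eq_iff:
  fixes k m :: nat
  assumes "k \<ge> 1"
  shows "m = k*(3*k-1) div 2 \<longleftrightarrow> (6*k-1)^2 = 24*m+1"
    and "m = k*(3*k+1) div 2 \<longleftrightarrow> (6*k+1)^2 = 24*m+1"
proof -
  have "y = z div 2 \<longleftrightarrow> z = 2 * y" if "even z" for y z :: nat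
    using that by presburger
  moreover have "even (k*(3*k-1))" "even (k*(3*k+1))"
    using assms by auto
  ultimately have e: "m = k*(3*k-1) div 2 \<longleftrightarrow> k*(3*k-1) = 2*m" "m = k*(3*k+1) div 2 \<longleftrightarrow> k*(3*k+1) = 2*m"
    by blast+
  obtain j where k: "k = Suc j"
    using assms by (cases k) auto
  have "(6*k-1)^2 = 12 * (k*(3*k-1)) + 1" "(6*k+1)^2 = 12 * (k*(3*k+1)) + 1"
    unfolding k by (simp_all add: power2_eq_square algebra_simps)
  then show "m = k*(3*k-1) div 2 \<longleftrightarrow> (6*k-1)^2 = 24*m+1" "m = k*(3*k+1) div 2 \<longleftrightarrow> (6*k+1)^2 = 24*m+1"
    unfolding e by auto
qed

text \<open>Signs vanish modulo 2, and a nonzero pentagonal number comes from exactly one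
  \<open>k\<close> and one of the two families, so no terms cancel.\<close>

lemma prod_one_minus_X_power_nth_mod2:
  assumes "m \<le> n"
  shows "(\<Prod>i=1..n. 1 - fps_X^i) $ m = euler_mod2 $ m"
proof -
  have minus: "(- 1 :: bit fps) = 1"
    by (simp add: fps_eq_iff)
  have "(\<Prod>i=1..n. 1 - fps_X^i) $ m = of_bool (m = 0) +
     (\<Sum>k=1..n. of_bool ((6*k-1)^2 = 24*m+1) + of_bool ((6*k+1)^2 = 24*m+1) :: bit)"
    unfolding prod_one_minus_X_power_nth[OF assms] minus fps_add_nth fps_sum_nth
  proof (intro arg_cong2[where f = "(+)"] sum.cong refl)
    fix k assume "k \<in> {1..n}"
    then show "(1 ^ k * (fps_X ^ (k * (3 * k - 1) div 2) + fps_X ^ (k * (3 * k + 1) div 2)) :: bit fps) $ m =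
      of_bool ((6 * k - 1)\<^sup>2 = 24 * m + 1) + of_bool ((6 * k + 1)\<^sup>2 = 24 * m + 1)"
      by (simp add: pentagonal_eq_iff[symmetric] of_bool_def del: One_nat_def)
  qed simp
  also have "\<dots> = euler_mod2 $ m"
  proof (cases "\<exists>x. x^2 = 24*m + 1")
    case False
    then have "m \<noteq> 0"
      by (metis mult_0_right one_power2 plus_nat.add_0)
    with False show ?thesis
      by (simp add: euler_mod2_def)
  next
    case True
    then obtain x where x: "x^2 = 24*m + 1" by auto
    have root: "y^2 = 24*m + 1 \<longleftrightarrow> y = x" for y
      unfolding x[symmetric] by (simp add: power2_eq_iff_nonneg)
    \<comment> \<open>This bound keeps the index \<open>k\<close> with \<open>x = 6 * k + 1\<close>
      or \<open>x = 6 * k - 1\<close> inside the range of summation.\<close>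
    have xn: "x \<le> 5 * n + 1"
    proof (rule ccontr)
      assume "\<not> x \<le> 5 * n + 1"
      then have "(5*n+2)^2 \<le> x^2"
        by (intro power_mono) auto
      then have "25 * n^2 + 20 * n + 4 \<le> 24 * n + 1"
        using x assms by (simp add: power2_eq_square algebra_simps)
      moreover have "n \<le> n^2" by (simp add: power2_eq_square)
      ultimately show False by linarith
    qed
    have "(of_bool (m = 0) + (\<Sum>k=1..n. of_bool (6*k-1 = x) + of_bool (6*k+1 = x)) :: bit) = 1"
      using square_eq_24_mult_plus_1_imp_mod_6[OF x]
    proof
      assume x1: "x mod 6 = 1"
      \<comment> \<open>Here \<open>k = 0\<close> can occur, exactly for \<open>m = 0\<close>; then
        the leading \<open>of_bool (m = 0)\<close> supplies the 1.\<close>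
      define k where "k = x div 6"
      have xk: "x = 6 * k + 1" using x1 unfolding k_def by presburger
      have "6*j-1 \<noteq> x" if "j \<ge> 1" for j :: nat using x1 that by presburger
      then have "(\<Sum>k=1..n. of_bool (6*k-1 = x) + of_bool (6*k+1 = x) :: bit) = (\<Sum>j=1..n. of_bool (j = k))"
        by (intro sum.cong) (auto simp: xk)
      also have "\<dots> = of_bool (k \<in> {1..n})"
        by (simp add: of_bool_def)
      also have "k \<in> {1..n} \<longleftrightarrow> m \<noteq> 0"
        using x xk xn by (cases k; cases m) (auto simp: power2_eq_square)
      finally show ?thesis by (cases "m = 0") auto
    next
      assume x5: "x mod 6 = 5"
      define k where "k = x div 6 + 1"
      have xk: "x = 6 * k - 1" "k \<ge> 1" using x5 unfolding k_def by presburger+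
      have "6*j+1 \<noteq> x" for j :: nat using x5 by presburger
      then have "(\<Sum>k=1..n. of_bool (6*k-1 = x) + of_bool (6*k+1 = x) :: bit) = (\<Sum>j=1..n. of_bool (j = k))"
        using xk by (intro sum.cong) auto
      also have "\<dots> = of_bool (k \<in> {1..n})"
        by (simp add: of_bool_def)
      also have "k \<in> {1..n}"
        using xk xn x5 by auto
      moreover have "m \<noteq> 0"
        using x x5 by (cases m) auto
      ultimately show ?thesis by simp
    qed
    then show ?thesis
      by (simp only: root euler_mod2_def fps_nth_Abs_fps) simp
  qed
  finally show ?thesis .
qed

subsection \<open>Generating functions of partitions\<close>

lemma finite_multisets_sum_mset_eq:
  "finite {p :: nat multiset. (\<forall>x\<in>#p. 0 < x) \<and> sum_mset p = n}"
proof (rule finite_subset)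
  show "finite (mset ` {xs. set xs \<subseteq> {..n} \<and> length xs \<le> n})"
    by (intro finite_imageI finite_lists_length_le) auto
  show "{p. (\<forall>x\<in>#p. 0 < x) \<and> sum_mset p = n} \<subseteq> mset ` {xs. set xs \<subseteq> {..n} \<and> length xs \<le> n}"
  proof
    fix p :: "nat multiset"
    assume p: "p \<in> {p. (\<forall>x\<in>#p. 0 < x) \<and> sum_mset p = n}"
    obtain xs where xs: "p = mset xs"
      by (metis ex_mset)
    have "(\<forall>x\<in>set ys. 0 < x) \<Longrightarrow> length ys \<le> sum_list ys" for ys :: "nat list"
      by (induction ys) auto
    then have "length xs \<le> sum_list xs"
      using p unfolding xs by auto
    moreover have "x \<le> sum_list xs" if "x \<in> set xs" for x
      using that by (rule member_le_sum_list) auto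
    ultimately show "p \<in> mset ` {xs. set xs \<subseteq> {..n} \<and> length xs \<le> n}"
      using p xs by (auto simp: sum_mset_sum_list)
  qed
qed

definition partitions_into :: "nat set \<Rightarrow> nat \<Rightarrow> nat multiset set" where
  "partitions_into A n = {p. set_mset p \<subseteq> A \<and> sum_mset p = n}"

lemma finite_partitions_into:
  assumes "0 \<notin> A"
  shows "finite (partitions_into A n)"
  by (rule finite_subset[OF _ finite_multisets_sum_mset_eq[of n]])
     (use assms in \<open>auto simp: partitions_into_def intro!: gr0I\<close>)

text \<open>Partitions that use \<open>a\<close> correspond to partitions of \<open>n - a\<close> by
  removing one copy of \<open>a\<close>.\<close>

lemma card_partitions_into_insert:
  assumes "0 \<notin> A" "a \<notin> A" "a > 0"
  shows "card (partitions_into (insert a A) n) = card (partitions_into A n) +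
    (if n < a then 0 else card (partitions_into (insert a A) (n - a)))"
proof -
  let ?C = "{p \<in> partitions_into (insert a A) n. a \<in># p}"
  have "partitions_into (insert a A) n = partitions_into A n \<union> ?C"
    using assms by (auto simp: partitions_into_def)
  moreover have "partitions_into A n \<inter> ?C = {}"
    using assms by (auto simp: partitions_into_def)
  moreover have "finite (partitions_into A n)" "finite (partitions_into (insert a A) n)"
    using assms by (auto intro!: finite_partitions_into)
  ultimately have "card (partitions_into (insert a A) n) = card (partitions_into A n) + card ?C"
    by (metis (no_types, lifting) card_Un_disjoint finite_Un)
  moreover have "?C = {}" if "n < a"
    using that by (auto simp: partitions_into_def dest!: multi_member_split)
  moreover have "?C = add_mset a ` partitions_into (insert a A) (n - a)" if "\<not> n < a"
  proof (intro equalityI subsetI)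
    fix p assume p: "p \<in> ?C"
    then obtain r where r: "p = add_mset a r"
      by (auto dest: multi_member_split)
    then show "p \<in> add_mset a ` partitions_into (insert a A) (n - a)"
      using p by (auto simp: partitions_into_def)
  qed (use that in \<open>auto simp: partitions_into_def\<close>)
  then have "card ?C = card (partitions_into (insert a A) (n - a))" if "\<not> n < a"
    using that by (simp add: card_image inj_on_def)
  ultimately show ?thesis
    by (cases "n < a") (simp_all only: card.empty if_True if_False simp_thms)
qed

definition partitions_into_fps :: "nat set \<Rightarrow> 'a::comm_ring_1 fps" where
  "partitions_into_fps A = Abs_fps (\<lambda>n. of_nat (card (partitions_into A n)))"

text \<open>The recurrence says P = P' + X^a P, where P' is the series without the part
  \<open>a\<close>; thus each factor 1 - X^a removes one admissible part.\<close>

lemma partitions_into_fps_mult_prod: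
  assumes "finite A" "0 \<notin> A"
  shows "partitions_into_fps A * (\<Prod>a\<in>A. 1 - fps_X^a) = (1 :: 'a::comm_ring_1 fps)"
  using assms
proof (induction A rule: finite_induct)
  case empty
  have "partitions_into {} n = (if n = 0 then {{#}} else {})" for n
    by (auto simp: partitions_into_def)
  then show ?case
    by (simp add: partitions_into_fps_def fps_eq_iff)
next
  case (insert a A)
  let ?P = "partitions_into_fps (insert a A) :: 'a fps"
  have "?P = partitions_into_fps A + fps_X^a * ?P"
    using insert by (auto simp: fps_eq_iff partitions_into_fps_def card_partitions_into_insert fps_X_power_mult_nth)
  then have "?P * (1 - fps_X^a) = partitions_into_fps A"
    by (simp add: algebra_simps)
  then have "?P * (\<Prod>a\<in>insert a A. 1 - fps_X^a) = partitions_into_fps A * (\<Prod>a\<in>A. 1 - fps_X^a)"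
    using insert by (simp add: mult.assoc[symmetric])
  then show ?case
    using insert by simp
qed

section \<open>Substitution of powers and the series of l-regular partitions\<close>

lemma fps_compose_X_power_nth:
  fixes f :: "'a::comm_ring_1 fps"
  assumes "k > 0"
  shows "(f oo fps_X^k) $ n = (if k dvd n then f $ (n div k) else 0)"
proof -
  have "(f oo fps_X^k) $ n = (\<Sum>i=0..n. if n = k * i then f $ i else 0)"
    by (auto simp: fps_compose_nth power_mult[symmetric] intro!: sum.cong)
  also have "\<dots> = (\<Sum>i=0..n. if i = n div k \<and> k dvd n then f $ i else 0)"
    using assms by (intro sum.cong) auto
  also have "\<dots> = (if k dvd n then f $ (n div k) else 0)"
    by (auto simp: sum.delta)
  finally show ?thesis .
qed

lemma one_minus_X_power_compose:
  assumes "l > 0"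
  shows "(\<Prod>i=1..n. 1 - fps_X^i) oo fps_X^l = (\<Prod>i=1..n. 1 - fps_X^(l*i) :: 'a::idom fps)"
  using assms by (simp add: fps_compose_prod_distrib fps_compose_sub_distrib fps_compose_power[symmetric] power_mult)

definition regular_fps :: "nat \<Rightarrow> bit fps" where
  "regular_fps l = Abs_fps (\<lambda>n. of_nat (b l n))"

text \<open>Up to degree \<open>n\<close> finite products suffice: the parts not divisible by
  \<open>l\<close> cancel their factors of the Euler product, leaving the factors at multiples of
  \<open>l\<close>.\<close>

lemma regular_fps_mult_euler:
  assumes "l > 0"
  shows "regular_fps l * euler_mod2 = euler_mod2 oo fps_X^l"
proof (rule fps_ext)
  fix n
  \<comment> \<open>With the bound \<open>l*n\<close>, the complement of \<open>A\<close> in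
    \<open>{1..l*n}\<close> is exactly the set of \<open>l * i\<close> with \<open>i\<close> from 1
    to \<open>n\<close>.\<close>
  define A where "A = {i \<in> {1..l*n}. \<not> l dvd i}"
  let ?P = "partitions_into_fps A :: bit fps"
  have le: "n \<le> l * n"
    using assms by simp
  have B: "regular_fps l $ m = ?P $ m" if "m \<le> n" for m
  proof -
    have "{p \<in> partitions m. \<forall>x\<in>#p. \<not> l dvd x} = partitions_into A m"
    proof (intro equalityI subsetI)
      fix p assume p: "p \<in> {p \<in> partitions m. \<forall>x\<in>#p. \<not> l dvd x}"
      have "x \<le> m" if "x \<in># p" for x
        using p that by (auto simp: partitions_def dest!: multi_member_split)
      then have "x \<in> A" if "x \<in># p" for x
        using p that order_trans[OF order_trans[OF _ \<open>m \<le> n\<close>] le, of x]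
        by (simp add: partitions_def A_def Suc_le_eq)
      then show "p \<in> partitions_into A m"
        using p by (auto simp: partitions_def partitions_into_def)
    qed (auto simp: partitions_def partitions_into_def A_def)
    then show ?thesis
      by (simp add: regular_fps_def partitions_into_fps_def b_def)
  qed
  have "{1..l*n} = A \<union> (*) l ` {1..n}"
    using assms by (auto simp: A_def elim!: dvdE)
  moreover have "A \<inter> (*) l ` {1..n} = {}" "finite A"
    by (auto simp: A_def)
  moreover have "(\<Prod>i\<in>(*) l ` {1..n}. 1 - fps_X^i :: bit fps) = (\<Prod>i=1..n. 1 - fps_X^(l*i))"
    using assms by (subst prod.reindex) (auto simp: inj_on_def)
  ultimately have split: "(\<Prod>i=1..l*n. 1 - fps_X^i :: bit fps) =
      (\<Prod>i\<in>A. 1 - fps_X^i) * (\<Prod>i=1..n. 1 - fps_X^(l*i))"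
    by (simp add: prod.union_disjoint)
  have "(regular_fps l * euler_mod2) $ n = (?P * (\<Prod>i=1..l*n. 1 - fps_X^i)) $ n"
    unfolding fps_mult_nth
    using le by (intro sum.cong arg_cong2[where f = "(*)"] B prod_one_minus_X_power_nth_mod2[symmetric]) (auto intro: order_trans[OF diff_le_self])
  also have "?P * (\<Prod>i=1..l*n. 1 - fps_X^i) = (\<Prod>i=1..n. 1 - fps_X^(l*i))"
    unfolding split mult.assoc[symmetric]
    by (subst partitions_into_fps_mult_prod) (auto simp: A_def)
  also have "\<dots> = (\<Prod>i=1..n. 1 - fps_X^i) oo fps_X^l"
    using assms by (rule one_minus_X_power_compose[symmetric])
  also have "\<dots> $ n = (euler_mod2 oo fps_X^l) $ n"
    unfolding fps_compose_X_power_nth[OF assms]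
    using prod_one_minus_X_power_nth_mod2[of "n div l" n] by simp
  finally show "(regular_fps l * euler_mod2) $ n = (euler_mod2 oo fps_X^l) $ n" .
qed

subsection \<open>Coefficients of products as representation numbers\<close>

text \<open>In the convolution the terms at \<open>i\<close> and \<open>n - i\<close> cancel in
  characteristic 2; only the middle term survives, and \<open>a * a = a\<close> for bits.\<close>

lemma square_bit_fps:
  fixes f :: "bit fps"
  shows "f^2 = f oo fps_X^2"
proof (rule fps_ext)
  fix n
  let ?t = "\<lambda>i. f $ i * f $ (n - i)"
  have two: "a + a = 0" "a * a = a" for a :: bit
    by (cases a; simp)+
  have "(\<Sum>i\<in>{0..n} - {i. 2 * i = n}. ?t i) = 0"
    by (rule sum_involution_eq_0[where h = "\<lambda>i. n - i"]) (auto simp: mult.commute two)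
  moreover have "{i\<in>{0..n}. 2 * i = n} = (if even n then {n div 2} else {})"
    by auto
  moreover have "{0..n} = ({0..n} - {i. 2 * i = n}) \<union> {i\<in>{0..n}. 2 * i = n}"
    by auto
  then have "sum ?t {0..n} = sum ?t ({0..n} - {i. 2 * i = n}) + sum ?t {i\<in>{0..n}. 2 * i = n}"
    by (subst sum.union_disjoint[symmetric]) auto
  ultimately have "sum ?t {0..n} = (if even n then f $ (n div 2) else 0)"
    by (auto simp: two elim!: evenE)
  then show "(f^2) $ n = (f oo fps_X^2) $ n"
    unfolding power2_eq_square[of f] fps_mult_nth using fps_compose_X_power_nth[of 2 f n] by simp
qed

lemma square_bit_fps_nth:
  fixes f :: "bit fps"
  shows "(f^2) $ n = (if even n then f $ (n div 2) else 0)"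
  by (simp add: square_bit_fps[of f] fps_compose_X_power_nth)

lemma square_eq_24_mult_plus_1_iff:
  fixes x :: nat
  shows "(\<exists>i. x^2 = 24*i+1) \<longleftrightarrow> odd x \<and> \<not> 3 dvd x"
proof
  assume "\<exists>i. x^2 = 24*i+1"
  then have "x mod 6 = 1 \<or> x mod 6 = 5"
    using square_eq_24_mult_plus_1_imp_mod_6 by blast
  then show "odd x \<and> \<not> 3 dvd x"
    by presburger
next
  assume "odd x \<and> \<not> 3 dvd x"
  then have "x = 1 \<or> (\<exists>k\<ge>1. x = 6*k-1 \<or> x = 6*k+1)"
    by presburger
  then show "\<exists>i. x^2 = 24*i+1"
    using pentagonal_eq_iff by (metis mult_0_right one_power2 plus_nat.add_0)
qed

text \<open>Being prime to 6 is equivalent to having a square of the form 24i + 1, the support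
  condition of \<open>euler_mod2\<close>.\<close>

definition diagonal_reps :: "nat \<Rightarrow> nat \<Rightarrow> nat \<Rightarrow> (nat \<times> nat) set" where
  "diagonal_reps a c m = {(x, y). odd x \<and> odd y \<and> \<not> 3 dvd x \<and> \<not> 3 dvd y \<and> a * x^2 + c * y^2 = m}"

lemma euler_compose_mult_nth:
  assumes "a > 0" "c > 0"
  shows "((euler_mod2 oo fps_X^a) * (euler_mod2 oo fps_X^c)) $ n =
    of_nat (card (diagonal_reps a c (24 * n + a + c)))"
proof -
  let ?R = "diagonal_reps a c (24 * n + a + c)"
  define I where "I = {i \<in> {0..n}. a dvd i \<and> c dvd (n - i) \<and>
    (\<exists>x. x^2 = 24 * (i div a) + 1) \<and> (\<exists>y. y^2 = 24 * ((n - i) div c) + 1)}"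
  \<comment> \<open>For x^2 = 24i + 1, \<open>g\<close> returns \<open>a * i\<close>, the index of
    the convolution term to which the representation belongs.\<close>
  define g where "g = (\<lambda>(x::nat, y::nat). a * ((x^2 - 1) div 24))"
  have R: "\<exists>i j. x^2 = 24*i+1 \<and> y^2 = 24*j+1 \<and> a * i + c * j = n" if "(x, y) \<in> ?R" for x y
  proof -
    from that obtain i j where ij: "x^2 = 24*i+1" "y^2 = 24*j+1"
      using square_eq_24_mult_plus_1_iff[of x] square_eq_24_mult_plus_1_iff[of y]
      by (auto simp: diagonal_reps_def)
    then have "a * i + c * j = n"
      using that unfolding diagonal_reps_def by (simp add: algebra_simps)
    with ij show ?thesis by blast
  qed
  have "inj_on g ?R"
  proof (rule inj_onI)
    fix p p' assume p: "p \<in> ?R" "p' \<in> ?R" and g: "g p = g p'"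
    obtain x y x' y' where xy: "p = (x, y)" "p' = (x', y')"
      by (cases p; cases p') auto
    obtain i j i' j' where *: "x^2 = 24*i+1" "y^2 = 24*j+1" "a * i + c * j = n"
        "x'^2 = 24*i'+1" "y'^2 = 24*j'+1" "a * i' + c * j' = n"
      using R p xy by metis
    have "i = i'"
      using g * assms by (simp add: g_def xy)
    with * assms have "j = j'"
      by auto
    with * \<open>i = i'\<close> have "x^2 = x'^2" "y^2 = y'^2"
      by auto
    then show "p = p'"
      by (simp add: xy power2_eq_iff_nonneg)
  qed
  moreover have "g ` ?R = I"
  proof (intro equalityI subsetI)
    fix k assume "k \<in> g ` ?R"
    then obtain x y where xy: "(x, y) \<in> ?R" "k = g (x, y)"
      by auto
    obtain i j where *: "x^2 = 24*i+1" "y^2 = 24*j+1" "a * i + c * j = n"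
      using R xy by metis
    have k: "k = a * i"
      using xy * by (simp add: g_def)
    moreover have "n - k = c * j"
      using * k by auto
    ultimately show "k \<in> I"
      using * assms unfolding I_def by auto
  next
    fix k assume "k \<in> I"
    then obtain i j x y where *: "k = a * i" "n - k = c * j" "k \<le> n" "x^2 = 24 * i + 1" "y^2 = 24 * j + 1"
      using assms unfolding I_def by (auto elim!: dvdE)
    have "a * i + c * j = n"
      using * by linarith
    then have "a * x^2 + c * y^2 = 24 * n + a + c"
      by (auto simp: * algebra_simps)
    then have "(x, y) \<in> ?R"
      using * square_eq_24_mult_plus_1_iff[of x] square_eq_24_mult_plus_1_iff[of y]
      unfolding diagonal_reps_def by blast
    moreover have "g (x, y) = k"
      using * by (simp add: g_def)
    ultimately show "k \<in> g ` ?R"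
      by (metis image_eqI)
  qed
  ultimately have "card ?R = card I"
    by (metis card_image)
  have "((euler_mod2 oo fps_X^a) * (euler_mod2 oo fps_X^c)) $ n = (\<Sum>i=0..n. of_bool (i \<in> I))"
    unfolding fps_mult_nth
    by (intro sum.cong) (auto simp: fps_compose_X_power_nth assms euler_mod2_def I_def)
  also have "\<dots> = of_nat (card ({0..n} \<inter> I))"
    by (simp add: Int_def)
  also have "{0..n} \<inter> I = I"
    by (auto simp: I_def)
  finally show ?thesis
    using \<open>card ?R = card I\<close> by simp
qed

subsection \<open>Parity of representation numbers\<close>

lemma card_eq_double_if_involution:
  assumes "finite S" and "\<And>x. x \<in> S \<Longrightarrow> h x \<in> S \<and> h (h x) = x \<and> P (h x) = (\<not> P x)"
  shows "card S = 2 * card {x \<in> S. P x}"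
proof -
  have "bij_betw h {x \<in> S. P x} {x \<in> S. \<not> P x}"
    by (rule bij_betw_byWitness[where f' = h]) (use assms in auto)
  then have "card {x \<in> S. P x} = card {x \<in> S. \<not> P x}"
    by (rule bij_betw_same_card)
  moreover have "card S = card {x \<in> S. P x} + card {x \<in> S. \<not> P x}"
    using assms by (subst card_Un_disjoint[symmetric]) (auto intro: arg_cong[where f = card])
  ultimately show ?thesis
    by simp
qed

text \<open>The set is halved by the sign of the first coordinate, then by that of the
  second.\<close>

lemma four_dvd_card_if_sign_invariant:
  fixes S :: "(int \<times> int) set"
  assumes "finite S"
    and "\<And>x y. (x, y) \<in> S \<Longrightarrow> (-x, y) \<in> S \<and> (x, -y) \<in> S \<and> x \<noteq> 0 \<and> y \<noteq> 0"
  shows "4 dvd card S"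
proof -
  have "card S = 2 * card {p \<in> S. fst p > 0}"
    by (rule card_eq_double_if_involution[where h = "\<lambda>(x, y). (-x, y)"]) (use assms in force)+
  also have "card {p \<in> S. fst p > 0} = 2 * card {p \<in> {p \<in> S. fst p > 0}. snd p > 0}"
    by (rule card_eq_double_if_involution[where h = "\<lambda>(x, y). (x, -y)"]) (use assms in force)+
  finally show ?thesis
    by simp
qed

lemma card_positive_square_root:
  assumes "(m::nat) > 0" "c > 0"
  shows "card {z::int. z > 0 \<and> int c * z^2 = int m} = of_bool (\<exists>z. c * z^2 = m)"
proof (cases "\<exists>z. c * z^2 = m")
  case True
  then obtain w where w: "c * w^2 = m" by auto
  then have "w > 0" using assms by (auto intro!: gr0I)
  have "{z::int. z > 0 \<and> int c * z^2 = int m} = {int w}"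
  proof (intro equalityI subsetI)
    fix z :: int assume z: "z \<in> {z. z > 0 \<and> int c * z^2 = int m}"
    then have "int c * z^2 = int m" "z > 0" by auto
    moreover have "int m = int c * (int w)^2" unfolding w[symmetric] by simp
    ultimately have "z^2 = (int w)^2" "z > 0" using assms by auto
    then have "z^2 = (int w)^2" "z \<ge> 0" by auto
    then have "z = int w" by (simp add: power2_eq_iff_nonneg)
    then show "z \<in> {int w}" by simp
  qed (use \<open>w > 0\<close> in \<open>auto simp flip: w\<close>)
  with True show ?thesis by simp
next
  case False
  have "c * (nat z)^2 = m" if "z > 0" "int c * z^2 = int m" for z :: int
  proof -
    have "int (c * (nat z)^2) = int m" using that by simp
    then show ?thesis by (simp only: of_nat_eq_iff)
  qed
  with False have "{z::int. z > 0 \<and> int c * z^2 = int m} = {}" by blast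
  with False show ?thesis by (simp only: card.empty of_bool_eq)
qed

section \<open>Solutions of u^2 + d v^2 = m\<close>

lemma finite_norm_form_reps:
  assumes "d > 0"
  shows "finite {(u, v). u^2 + int d * v^2 = int m}"
proof (rule finite_subset)
  show "{(u, v). u^2 + int d * v^2 = int m} \<subseteq> {-int m..int m} \<times> {-int m..int m}"
  proof safe
    fix u v :: int assume eq: "u^2 + int d * v^2 = int m"
    have le: "\<bar>z\<bar> \<le> z^2" for z :: int
    proof -
      have "z = 0 \<or> 1 \<le> \<bar>z\<bar>" by linarith
      then show ?thesis
        using self_le_power[of "\<bar>z\<bar>" 2] by auto
    qed
    have "v^2 \<le> int d * v^2"
      using assms by (simp add: mult_le_cancel_right1)
    then have "u^2 \<le> int m" "v^2 \<le> int m"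
      using eq zero_le_power2[of u] zero_le_power2[of v] by linarith+
    then show "u \<in> {-int m..int m}" "v \<in> {-int m..int m}"
      using le[of u] le[of v] by auto
  qed
qed auto

text \<open>Solutions off the axes come in fours, those on an axis in pairs; each axis holds at most
  one pair.\<close>

lemma card_norm_form_reps:
  assumes "m > 0" "d > 0"
  obtains r where "card {(u, v). u^2 + int d * v^2 = int m} =
    4 * r + 2 * of_bool (\<exists>z. z^2 = m) + 2 * of_bool (\<exists>z. d * z^2 = m)"
proof -
  define S where "S = {(u, v). u^2 + int d * v^2 = int m}"
  define S1 where "S1 = {(u, v) \<in> S. u \<noteq> 0 \<and> v \<noteq> 0}"
  define S2 where "S2 = {(u, v) \<in> S. v = 0}"
  define S3 where "S3 = {(u, v) \<in> S. u = 0}"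
  have fin: "finite S"
    unfolding S_def using assms(2) by (rule finite_norm_form_reps)
  have "4 dvd card S1"
    by (rule four_dvd_card_if_sign_invariant) (auto simp: S1_def S_def intro: finite_subset[OF _ fin])
  then obtain r where r: "card S1 = 4 * r" by auto
  have fin': "finite S1" "finite S2" "finite S3"
    by (auto simp: S1_def S2_def S3_def intro: finite_subset[OF _ fin])
  have "card S2 = 2 * card {p \<in> S2. fst p > 0}"
    by (rule card_eq_double_if_involution[where h = "\<lambda>(x, y). (-x, y)"])
       (use assms fin' in \<open>auto simp: S2_def S_def not_less le_less\<close>)
  also have "{p \<in> S2. fst p > 0} = (\<lambda>z. (z, 0)) ` {z::int. z > 0 \<and> int 1 * z^2 = int m}"
    by (auto simp: S2_def S_def)
  also have "card \<dots> = of_bool (\<exists>z. 1 * z^2 = m)"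
    using assms card_positive_square_root[of m 1] by (subst card_image) (auto simp: inj_on_def)
  finally have 2: "card S2 = 2 * of_bool (\<exists>z. z^2 = m)" by simp
  have "card S3 = 2 * card {p \<in> S3. snd p > 0}"
    by (rule card_eq_double_if_involution[where h = "\<lambda>(x, y). (x, -y)"])
       (use assms fin' in \<open>auto simp: S3_def S_def not_less le_less\<close>)
  also have "{p \<in> S3. snd p > 0} = (\<lambda>z. (0, z)) ` {z::int. z > 0 \<and> int d * z^2 = int m}"
    by (auto simp: S3_def S_def)
  also have "card \<dots> = of_bool (\<exists>z. d * z^2 = m)"
    using assms card_positive_square_root[of m d] by (subst card_image) (auto simp: inj_on_def)
  finally have 3: "card S3 = 2 * of_bool (\<exists>z. d * z^2 = m)" .
  have "S = S1 \<union> (S2 \<union> S3)" by (auto simp: S1_def S2_def S3_def)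
  moreover have "S1 \<inter> (S2 \<union> S3) = {}" "S2 \<inter> S3 = {}"
    using assms by (auto simp: S1_def S2_def S3_def S_def)
  ultimately have "card S = card S1 + (card S2 + card S3)"
    using fin' by (simp add: card_Un_disjoint)
  with r 2 3 show thesis
    by (intro that[of r]) (simp add: S_def)
qed

section \<open>Multiplication by 1 + sqrt(-d)\<close>

lemma three_dvd_square_iff: "3 dvd x^2 \<longleftrightarrow> 3 dvd (x::int)"
proof -
  have "x mod 3 \<in> {0, 1, 2}" by auto
  then have "(x mod 3)^2 mod 3 = 0 \<longleftrightarrow> x mod 3 = 0" by auto
  then show ?thesis by (simp add: power_mod dvd_eq_mod_eq_0)
qed

text \<open>
  The map \<open>(u, v) \<mapsto> (u - d v, u + v)\<close> is multiplication by \<open>1 + \<surd>-d\<close>; its image consists of the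
  solutions with \<open>x \<equiv> y\<close> modulo \<open>d + 1\<close>. Those with \<open>3\<close> dividing \<open>x\<close> (and then \<open>y\<close>) admit all sign
  changes, whereas for the others exactly one choice of the sign of \<open>y\<close> relative to \<open>x\<close> satisfies the
  congruence.
\<close>
lemma card_diagonal_reps:
  fixes d m :: nat
  assumes d: "d = 2 \<or> d = 5"
    and odd: "\<And>x y :: int. x^2 + int d * y^2 = int ((d + 1) * m) \<Longrightarrow> odd x \<and> odd y"
  obtains r where "card {(u, v). u^2 + int d * v^2 = int m} = 4 * r + 2 * card (diagonal_reps 1 d ((d + 1) * m))"
proof -
  define S where "S = {(u, v). u^2 + int d * v^2 = int m}"
  define W where "W = {(x, y). x^2 + int d * y^2 = int ((d + 1) * m) \<and> (int d + 1) dvd (x - y)}"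
  define W0 where "W0 = {(x, y) \<in> W. 3 dvd x}"
  define W1 where "W1 = {(x, y) \<in> W. \<not> 3 dvd x}"
  have fin: "finite W"
    by (rule finite_subset[OF _ finite_norm_form_reps[of d "(d + 1) * m"]]) (use d in \<open>auto simp: W_def\<close>)
  have dvd: "3 dvd x \<longleftrightarrow> 3 dvd y" if "x^2 + int d * y^2 = int ((d + 1) * m)" for x y
  proof -
    have "3 dvd x^2 - y^2"
    proof -
      have "x^2 - y^2 = 3 * (int ((d+1) div 3 * m) - int ((d+1) div 3) * y^2)"
        using that d by (auto simp: algebra_simps)
      then show ?thesis by simp
    qed
    then have "3 dvd x^2 \<longleftrightarrow> 3 dvd y^2"
      by (meson dvd_diff_right_iff dvd_diff_left_iff)
    then show ?thesis
      by (simp only: three_dvd_square_iff)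
  qed
  \<comment> \<open>Since \<open>d + 1\<close> is 3 or 6 and sums and differences of odd numbers are
    even, the congruence between \<open>x\<close> and \<open>y\<close> only matters modulo
    3.\<close>
  have full: "(int d + 1) dvd z \<longleftrightarrow> 3 dvd z" if "even z" for z
    using d that by (elim disjE; simp; presburger)
  have "inj_on (\<lambda>(u, v). (u - int d * v, u + v)) S"
  proof (rule inj_onI, clarify)
    fix u v u' v' assume *: "u - int d * v = u' - int d * v'" "u + v = u' + v'"
    then have "(int d + 1) * v = (int d + 1) * v'" by (simp add: algebra_simps)
    then have "v = v'" using d by auto
    with * show "u = u' \<and> v = v'" by simp
  qed
  moreover have "(\<lambda>(u, v). (u - int d * v, u + v)) ` S = W"
  proof (intro equalityI subsetI)
    fix p assume "p \<in> (\<lambda>(u, v). (u - int d * v, u + v)) ` S"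
    then obtain u v where uv: "u^2 + int d * v^2 = int m" "p = (u - int d * v, u + v)"
      by (auto simp: S_def)
    have "(u - int d * v)^2 + int d * (u + v)^2 = (int d + 1) * (u^2 + int d * v^2)"
      by (simp add: power2_eq_square algebra_simps)
    moreover have "u - int d * v - (u + v) = (int d + 1) * - v"
      by (simp add: algebra_simps)
    moreover have "int ((d + 1) * m) = (int d + 1) * (u^2 + int d * v^2)"
      unfolding uv(1) by (simp add: algebra_simps)
    ultimately show "p \<in> W"
      unfolding W_def uv(2) mem_Collect_eq prod.case by (metis dvd_triv_left)
  next
    fix p assume "p \<in> W"
    then obtain x y where xy: "p = (x, y)" "x^2 + int d * y^2 = int ((d + 1) * m)" "(int d + 1) dvd (x - y)"
      by (auto simp: W_def)
    \<comment> \<open>The preimage is u = y + k, v = -k, because x - y = -(d + 1) v.\<close>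
    then obtain k where k: "x - y = (int d + 1) * k" by auto
    have x: "x = (y + k) - int d * - k" using k by (simp add: algebra_simps)
    have "(int d + 1) * ((y + k)^2 + int d * (-k)^2) = x^2 + int d * y^2"
      unfolding x by (simp add: power2_eq_square algebra_simps)
    also have "\<dots> = (int d + 1) * int m" unfolding xy by (simp add: algebra_simps)
    finally have "(y + k, -k) \<in> S"
      unfolding S_def by (simp add: add_eq_0_iff)
    then show "p \<in> (\<lambda>(u, v). (u - int d * v, u + v)) ` S"
      unfolding xy(1) by (rule rev_image_eqI) (use x in auto)
  qed
  ultimately have "card S = card W"
    by (metis card_image)
  also have "\<dots> = card W0 + card W1"
    using fin by (subst card_Un_disjoint[symmetric])
      (auto simp: W0_def W1_def intro: arg_cong[where f = card] finite_subset[OF _ fin])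
  finally have SW: "card S = card W0 + card W1" .
  have "4 dvd card W0"
  proof (rule four_dvd_card_if_sign_invariant)
    show "finite W0" by (rule finite_subset[OF _ fin]) (auto simp: W0_def)
    fix x y assume "(x, y) \<in> W0"
    then have *: "x^2 + int d * y^2 = int ((d + 1) * m)" "3 dvd x"
      by (auto simp: W0_def W_def)
    have "3 dvd y" "odd x" "odd y"
      using dvd[OF *(1)] odd[OF *(1)] * by auto
    then have "(int d + 1) dvd (- x - y)" "(int d + 1) dvd (x - - y)"
      using * by (simp_all add: full)
    then show "(-x, y) \<in> W0 \<and> (x, -y) \<in> W0 \<and> x \<noteq> 0 \<and> y \<noteq> 0"
      using * \<open>odd x\<close> \<open>odd y\<close> by (auto simp: W0_def W_def)
  qed
  then obtain r where r: "card W0 = 4 * r" by auto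
  \<comment> \<open>On \<open>W1\<close> only the simultaneous sign change is available. The half
    with \<open>x > 0\<close> is then matched with the natural solutions by forgetting the sign of
    \<open>y\<close>.\<close>
  have "card W1 = 2 * card {p \<in> W1. fst p > 0}"
  proof (rule card_eq_double_if_involution[where h = "\<lambda>(x, y). (-x, -y)"])
    show "finite W1" by (rule finite_subset[OF _ fin]) (auto simp: W1_def)
    fix p assume "p \<in> W1"
    then obtain x y where p: "p = (x, y)" "(x, y) \<in> W" "\<not> 3 dvd x" by (auto simp: W1_def)
    then have "(int d + 1) dvd (- x - - y)" 
      unfolding W_def by (metis (mono_tags, lifting) case_prodD dvd_minus_iff mem_Collect_eq minus_diff_eq minus_diff_minus)
    then have "(-x, -y) \<in> W1" using p by (auto simp: W1_def W_def)
    moreover have "x \<noteq> 0" using p by auto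
    ultimately show "(case p of (x, y) \<Rightarrow> (- x, - y)) \<in> W1 \<and>
       (case case p of (x, y) \<Rightarrow> (- x, - y) of (x, y) \<Rightarrow> (- x, - y)) = p \<and>
       (0 < fst (case p of (x, y) \<Rightarrow> (- x, - y))) = (\<not> 0 < fst p)"
      unfolding p by auto
  qed
  also have "card {p \<in> W1. fst p > 0} = card (diagonal_reps 1 d ((d + 1) * m))"
  proof (rule bij_betw_same_card)
    let ?f = "\<lambda>(x::int, y::int). (nat x, nat \<bar>y\<bar>)"
    show "bij_betw ?f {p \<in> W1. fst p > 0} (diagonal_reps 1 d ((d + 1) * m))"
      unfolding bij_betw_def
    proof (intro conjI inj_onI equalityI subsetI)
      fix p p' assume *: "p \<in> {p \<in> W1. fst p > 0}" "p' \<in> {p \<in> W1. fst p > 0}" "?f p = ?f p'"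
      obtain x y x' y' where p: "p = (x, y)" "p' = (x', y')" by (cases p; cases p') auto
      have x: "x = x'" "\<bar>y\<bar> = \<bar>y'\<bar>" using * by (auto simp: p)
      have "y = y'"
      proof (rule ccontr)
        assume "y \<noteq> y'"
        then have y': "y' = - y" using x by arith
        have W: "(x, y) \<in> W" "(x, -y) \<in> W" "\<not> 3 dvd x" using *(1,2) unfolding p x(1) y' by (simp_all add: W1_def)
        then have o: "odd x" "odd y" using odd[of x y] by (auto simp: W_def)
        have "(int d + 1) dvd (x - y)" "(int d + 1) dvd (x - - y)" using W by (auto simp: W_def)
        then have "3 dvd (x - y)" "3 dvd (x + y)" using o by (simp_all add: full)
        then show False using \<open>\<not> 3 dvd x\<close> by presburger
      qed
      with x p show "p = p'" by simp
    next
      fix q assume "q \<in> ?f ` {p \<in> W1. fst p > 0}"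
      then obtain x y where q: "q = (nat x, nat \<bar>y\<bar>)" and W: "(x, y) \<in> W" "\<not> 3 dvd x" "x > 0"
        by (auto simp: W1_def)
      then have eq: "x^2 + int d * y^2 = int ((d + 1) * m)" by (auto simp: W_def)
      have o: "odd x" "odd y" "\<not> 3 dvd y" using odd[OF eq] dvd[OF eq] W by auto
      obtain a c where ac: "x = int a" "\<bar>y\<bar> = int c" using \<open>x > 0\<close> by (metis abs_ge_zero nonneg_int_cases order_less_imp_le)
      have "int (a^2 + d * c^2) = x^2 + int d * \<bar>y\<bar>^2" by (simp add: ac)
      also have "\<dots> = int ((d + 1) * m)" using eq by simp
      finally have "a^2 + d * c^2 = (d + 1) * m" by (simp only: of_nat_eq_iff)
      moreover have "odd a" "\<not> 3 dvd a" using o W unfolding ac by presburger+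
      moreover have "odd (int c)" "\<not> 3 dvd int c" using o unfolding ac(2)[symmetric] by auto
      then have "odd c" "\<not> 3 dvd c" by presburger+
      ultimately show "q \<in> diagonal_reps 1 d ((d + 1) * m)"
        unfolding q ac by (simp add: diagonal_reps_def)
    next
      fix q assume "q \<in> diagonal_reps 1 d ((d + 1) * m)"
      then obtain x y where q: "q = (x, y)" and o: "odd x" "odd y" "\<not> 3 dvd x" "\<not> 3 dvd y"
        and eq: "x^2 + d * y^2 = (d + 1) * m"
        by (auto simp: diagonal_reps_def)
      have eqi: "(int x)^2 + int d * (int y)^2 = int ((d + 1) * m)"
        unfolding eq[symmetric] by simp
      have "3 dvd int x - int y \<or> 3 dvd int x - (- int y)"
        using o by presburger
      then obtain z where z: "z = int y \<or> z = - int y" "3 dvd int x - z" by blast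
      then have "(int x, z) \<in> W"
        using eqi o by (auto simp: W_def full)
      moreover have "x > 0" "\<not> 3 dvd int x" using o by presburger+
      ultimately have "(int x, z) \<in> {p \<in> W1. fst p > 0}" by (auto simp: W1_def)
      moreover have "q = ?f (int x, z)" using z q by auto
      ultimately show "q \<in> ?f ` {p \<in> W1. fst p > 0}" by (rule rev_image_eqI)
    qed
  qed
  finally show thesis
    using SW r that[of r] by (simp add: S_def)
qed

text \<open>Equate the two counts of solutions of u^2 + d v^2 = m, halve, and reduce modulo
  2.\<close>

lemma card_diagonal_reps_mod2:
  fixes d m :: nat
  assumes "d = 2 \<or> d = 5" "m > 0"
    and "\<And>x y :: int. x^2 + int d * y^2 = int ((d + 1) * m) \<Longrightarrow> odd x \<and> odd y"
  shows "of_nat (card (diagonal_reps 1 d ((d + 1) * m))) =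
    (of_bool (\<exists>z. z^2 = m) + of_bool (\<exists>z. d * z^2 = m) :: bit)"
proof -
  have "d > 0" using assms by auto
  obtain r where r: "card {(u, v). u^2 + int d * v^2 = int m} = 4 * r + 2 * card (diagonal_reps 1 d ((d + 1) * m))"
    using card_diagonal_reps[of d m] assms by metis
  obtain s where s: "card {(u, v). u^2 + int d * v^2 = int m} =
    4 * s + 2 * of_bool (\<exists>z. z^2 = m) + 2 * of_bool (\<exists>z. d * z^2 = m)"
    using card_norm_form_reps[OF \<open>m > 0\<close> \<open>d > 0\<close>] by metis
  have "2 * r + card (diagonal_reps 1 d ((d + 1) * m)) = 2 * s + of_bool (\<exists>z. z^2 = m) + of_bool (\<exists>z. d * z^2 = m)"
    using r s by linarith
  then have "(of_nat (2 * r + card (diagonal_reps 1 d ((d + 1) * m))) :: bit) =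
    of_nat (2 * s + of_bool (\<exists>z. z^2 = m) + of_bool (\<exists>z. d * z^2 = m))"
    by (simp only:)
  then show ?thesis by simp
qed

subsection \<open>Dissection of the generating function of \<open>b 5\<close>\<close>

text \<open>This is Jacobi's identity for the cube of \<open>E\<close> modulo 2. It is the case
  \<open>d = 2\<close>: E^3 = E(q) E(q^2), and 24n + 3 = 3(8n + 1).\<close>

lemma euler_cube_nth: "(euler_mod2^3) $ n = of_bool (\<exists>z. z^2 = 8 * n + 1)"
proof -
  have odd: "odd x \<and> odd y" if eq: "x^2 + int 2 * y^2 = int ((2 + 1) * (8 * n + 1))" for x y :: int
  proof -
    have "odd (x^2 + int 2 * y^2)"
      unfolding eq by simp
    then have "odd x" by simp
    moreover have "odd y"
    proof
      \<comment> \<open>Then the left side is 1 modulo 4, but the right side is 3.\<close>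
      assume "even y"
      with \<open>odd x\<close> obtain i k where "x = 2 * i + 1" "y = 2 * k"
        by (auto elim!: oddE evenE)
      with eq have "4 * (i * i + i + 2 * (k * k)) = 24 * int n + 2"
        by (simp add: power2_eq_square algebra_simps)
      then show False by presburger
    qed
    ultimately show ?thesis by simp
  qed
  have "euler_mod2^3 = (euler_mod2 oo fps_X^1) * (euler_mod2 oo fps_X^2)"
    by (simp add: power3_eq_cube mult.assoc flip: square_bit_fps[of euler_mod2] power2_eq_square)
  also have "\<dots> $ n = of_nat (card (diagonal_reps 1 2 ((2 + 1) * (8 * n + 1))))"
  proof -
    have "24 * n + 1 + 2 = (2 + 1) * (8 * n + 1)" by simp
    then show ?thesis using euler_compose_mult_nth[of 1 2 n] by (simp only: zero_less_one zero_less_numeral simp_thms)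
  qed
  also have "\<dots> = of_bool (\<exists>z. z^2 = 8 * n + 1) + of_bool (\<exists>z. 2 * z^2 = 8 * n + 1)"
    by (rule card_diagonal_reps_mod2) (use odd in auto)
  also have "2 * z^2 \<noteq> 8 * n + 1" for z :: nat
    by presburger
  then have "(\<exists>z. 2 * z^2 = 8 * n + 1) \<longleftrightarrow> False"
    by blast
  finally show ?thesis by (simp only: of_bool_eq add_0_right)
qed

text \<open>Square the cube; if 4n + 1 is a square, then n = k(k + 1) is automatically even.\<close>

lemma euler_power6_nth: "(euler_mod2^6) $ n = of_bool (\<exists>z. z^2 = 4 * n + 1)"
proof -
  have "euler_mod2^6 = (euler_mod2^3)^2"
    by (simp flip: power_mult)
  also have "\<dots> $ n = of_bool (even n \<and> (\<exists>z. z^2 = 8 * (n div 2) + 1))"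
    unfolding square_bit_fps_nth by (auto simp: euler_cube_nth)
  also have "(even n \<and> (\<exists>z. z^2 = 8 * (n div 2) + 1)) \<longleftrightarrow> (\<exists>z. z^2 = 4 * n + 1)"
  proof
    assume "\<exists>z. z^2 = 4 * n + 1"
    then obtain z where z: "z^2 = 4 * n + 1" by auto
    then have "odd (z^2)" by simp
    then have "odd z" by simp
    then obtain k where "z = 2 * k + 1" by (auto elim!: oddE)
    with z have "n = k * (k + 1)"
      by (simp add: power2_eq_square algebra_simps)
    then have "even n" by simp
    then have "8 * (n div 2) + 1 = 4 * n + 1" by auto
    with z \<open>even n\<close> show "even n \<and> (\<exists>z. z^2 = 8 * (n div 2) + 1)" by metis
  qed (auto elim!: evenE)
  finally show ?thesis .
qed

text \<open>The case \<open>d = 5\<close>, as 24n + 6 = 6(4n + 1). The two indicators of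
  \<open>card_diagonal_reps_mod2\<close> become the two summands on the right.\<close>

lemma euler_mult_euler_compose_5:
  "euler_mod2 * (euler_mod2 oo fps_X^5) = euler_mod2^6 + fps_X * (euler_mod2 oo fps_X^5)^6"
proof (rule fps_ext)
  fix n
  have odd: "odd x \<and> odd y" if eq: "x^2 + int 5 * y^2 = int ((5 + 1) * (4 * n + 1))" for x y :: int
  proof (rule ccontr)
    assume *: "\<not> (odd x \<and> odd y)"
    have "even (x^2 + int 5 * y^2)" unfolding eq by simp
    with * have "even x" "even y" by auto
    then obtain i k where "x = 2 * i" "y = 2 * k" by (auto elim!: evenE)
    with eq have "4 * (i * i + 5 * (k * k)) = 24 * int n + 6"
      by (simp add: power2_eq_square algebra_simps)
    then show False by presburger
  qed
  have "(euler_mod2 * (euler_mod2 oo fps_X^5)) $ n = ((euler_mod2 oo fps_X^1) * (euler_mod2 oo fps_X^5)) $ n"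
    by simp
  also have "\<dots> = of_nat (card (diagonal_reps 1 5 ((5 + 1) * (4 * n + 1))))"
    by (subst euler_compose_mult_nth) simp_all
  also have "\<dots> = of_bool (\<exists>z. z^2 = 4 * n + 1) + of_bool (\<exists>z. 5 * z^2 = 4 * n + 1)"
    by (rule card_diagonal_reps_mod2) (use odd in auto)
  also have "of_bool (\<exists>z. 5 * z^2 = 4 * n + 1) = (fps_X * (euler_mod2 oo fps_X^5)^6) $ n"
  \<comment> \<open>The equation 5z^2 = 4n + 1 forces n = 5k + 1 and then z^2 = 4k + 1. The
    condition \<open>n > 0\<close> excludes the truncated \<open>0 - 1 = 0\<close>.\<close>
  proof (cases "5 dvd n - 1 \<and> n > 0")
    case True
    then obtain k where "n - 1 = 5 * k" by auto
    then have n: "n = 5 * k + 1" using True by simp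
    have "(\<exists>z. 5 * z^2 = 4 * n + 1) \<longleftrightarrow> (\<exists>z. z^2 = 4 * k + 1)"
      unfolding n by (intro arg_cong[where f = Ex] ext) auto
    then show ?thesis
      by (simp add: n fps_compose_power fps_compose_X_power_nth euler_power6_nth del: fps_mult_nth_1')
  next
    case False
    have "5 * w \<noteq> 4 * n + 1" for w :: nat using False by presburger
    then show ?thesis using False
      by (auto simp add: fps_compose_power fps_compose_X_power_nth)
  qed
  finally show "(euler_mod2 * (euler_mod2 oo fps_X^5)) $ n =
      (euler_mod2^6 + fps_X * (euler_mod2 oo fps_X^5)^6) $ n"
    by (simp add: euler_power6_nth)
qed

text \<open>Squares have only even exponents, so \<open>g\<close> and \<open>h\<close> are the even
  and odd parts of \<open>f\<close>.\<close>

lemma bit_fps_dissection: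
  fixes f g h :: "bit fps"
  assumes "f = g^2 + fps_X * h^2"
  shows "f $ (2 * n) = g $ n" and "f $ (2 * n + 1) = h $ n"
  unfolding assms by (simp_all add: square_bit_fps_nth fps_X_mult_nth)

lemma regular_5_mod2:
  "of_nat (b 5 (4 * m + 1)) = (of_nat (card (diagonal_reps 2 5 (24 * m + 7))) :: bit)"
proof -
  define E where "E = euler_mod2"
  define F where "F = euler_mod2 oo fps_X^5"
  define B where "B = regular_fps 5"
  have BE: "B * E = F"
    unfolding B_def E_def F_def by (rule regular_fps_mult_euler) simp
  have EF: "E * F = E^6 + fps_X * F^6"
    unfolding E_def F_def by (rule euler_mult_euler_compose_5)
  have "\<exists>x::nat. x^2 = 24 * 0 + 1"
    by (rule exI[of _ 1]) simp
  then have "E $ 0 = 1"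
    by (simp only: E_def euler_mod2_def fps_nth_Abs_fps of_bool_eq)
  then have "E \<noteq> 0" by auto
  \<comment> \<open>Both summands of E F = E^2 B are exhibited as multiples of E^2, which can be
    cancelled.\<close>
  have "F^6 = F^4 * (B * E)^2" "E^6 = E^2 * E^4"
    unfolding BE by (simp_all flip: power_add)
  moreover have "E^2 * B = E * F"
    by (simp flip: BE add: power2_eq_square ac_simps)
  ultimately have "E^2 * B = E^2 * (E^4 + fps_X * (F^4 * B^2))"
    unfolding EF by (simp add: power_mult_distrib algebra_simps)
  then have "B = E^4 + fps_X * (F^4 * B^2)"
    using \<open>E \<noteq> 0\<close> by simp
  then have B: "B = (E^2)^2 + fps_X * (F^2 * B)^2"
    by (simp add: power_mult_distrib flip: power_mult)
  \<comment> \<open>The odd part of \<open>B\<close> is \<open>F^2 * B\<close>; multiplying the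
    dissection of \<open>B\<close> by F^2 dissects it again.\<close>
  have "F^2 * B = F^2 * ((E^2)^2 + fps_X * (F^2 * B)^2)"
    using B by simp
  also have "\<dots> = (E^2 * F)^2 + fps_X * (F^3 * B)^2"
    by (simp add: eval_nat_numeral algebra_simps)
  finally have FB: "F^2 * B = (E^2 * F)^2 + fps_X * (F^3 * B)^2" .
  have "of_nat (b 5 (4 * m + 1)) = B $ (2 * (2 * m) + 1)"
    by (simp add: B_def regular_fps_def)
  also have "\<dots> = (F^2 * B) $ (2 * m)"
    by (rule bit_fps_dissection(2)[OF B])
  also have "\<dots> = (E^2 * F) $ m"
    by (rule bit_fps_dissection(1)[OF FB])
  also have "\<dots> = of_nat (card (diagonal_reps 2 5 (24 * m + 7)))"
    unfolding square_bit_fps[of E] unfolding E_def F_def by (subst euler_compose_mult_nth) (simp_all add: ac_simps)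
  finally show ?thesis .
qed

lemma bit_of_nat_eq_0_iff: "(of_nat n :: bit) = 0 \<longleftrightarrow> even n"
proof -
  have "a = 0 \<longleftrightarrow> even a" for a :: bit
    by (cases a) auto
  from this[of "of_nat n"] show ?thesis by (simp only: even_of_nat_iff)
qed

text \<open>For n = 4m + 1 the represented number 24m + 7 is 6n + 1, which clears the denominators
  in the four progressions.\<close>

lemma even_b_5_if_no_reps:
  assumes "n mod 4 = 1" and "\<And>x y. 2 * x^2 + 5 * y^2 \<noteq> 6 * n + 1"
  shows "even (b 5 n)"
proof -
  define m where "m = n div 4"
  have n: "n = 4 * m + 1" using assms(1) unfolding m_def by presburger
  have "diagonal_reps 2 5 (24 * m + 7) = {}"
    using assms(2) by (auto simp: diagonal_reps_def n add.commute)
  then have "(of_nat (b 5 n) :: bit) = 0"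
    unfolding n regular_5_mod2 by simp
  then show ?thesis by (simp only: bit_of_nat_eq_0_iff)
qed

subsection \<open>Descent at 5\<close>

lemma square_mod_5: "(x::nat)^2 mod 5 \<in> {0, 1, 4}"
proof -
  have "x mod 5 \<in> {0, 1, 2, 3, 4}" by auto
  then have "(x mod 5)^2 mod 5 \<in> {0, 1, 4}" by auto
  then show ?thesis by (simp add: power_mod)
qed

lemma five_dvd_square: "5 dvd x^2 \<Longrightarrow> 5 dvd (x::nat)"
proof -
  assume "5 dvd x^2"
  then have "(x mod 5)^2 mod 5 = 0" by (simp add: power_mod)
  moreover have "x mod 5 \<in> {0, 1, 2, 3, 4}" by auto
  ultimately show ?thesis by auto
qed

lemma reps_2_5_descent_step:
  assumes "2 * x^2 + 5 * y^2 = 5 * (r::nat)"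
  obtains z where "y^2 + 10 * z^2 = r"
proof -
  have "5 dvd x^2" using assms by presburger
  then obtain z where "x = 5 * z" using five_dvd_square by blast
  with assms have "y^2 + 10 * z^2 = r" by (simp add: power2_eq_square)
  then show thesis by (rule that)
qed

text \<open>If 25 divides 2x^2 + 5y^2, then 5 divides \<open>x\<close> and \<open>y\<close>, so the
  quotient is represented by the same form.\<close>

lemma reps_2_5_descent:
  assumes "2 * x^2 + 5 * y^2 = 5^(2*a) * (r::nat)"
  obtains x' y' where "2 * x'^2 + 5 * y'^2 = r"
  using assms
proof (induction a arbitrary: x y thesis)
  case 0
  then show ?case by auto
next
  case (Suc a)
  have "2 * x^2 + 5 * y^2 = 5 * (5 * (5^(2*a) * r))"
    using Suc.prems by simp
  then obtain z where z: "y^2 + 10 * z^2 = 5 * (5^(2*a) * r)"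
    by (rule reps_2_5_descent_step)
  then have "5 dvd y^2" by presburger
  then obtain w where "y = 5 * w" using five_dvd_square by blast
  with z have "2 * z^2 + 5 * w^2 = 5^(2*a) * r" by (simp add: power2_eq_square)
  then show ?case using Suc.IH Suc.prems(1) by blast
qed

lemma five_power_mod_24: "(5::nat)^(2*a) mod 24 = 1"
proof -
  have "(5::nat)^(2*a) mod 24 = (5^2 mod 24)^a mod 24"
    by (simp only: power_mult power_mod)
  then show ?thesis by simp
qed

theorem theorem3p20:
  fixes \<alpha> n :: nat
  shows "even (b 5 (4 * 5^(2*\<alpha>+1) * n + (31 * 5^(2*\<alpha>) - 1) div 6)) \<and>
         even (b 5 (4 * 5^(2*\<alpha>+1) * n + (79 * 5^(2*\<alpha>) - 1) div 6)) \<and>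
         even (b 5 (4 * 5^(2*\<alpha>+2) * n + (83 * 5^(2*\<alpha>+1) - 1) div 6)) \<and>
         even (b 5 (4 * 5^(2*\<alpha>+2) * n + (107 * 5^(2*\<alpha>+1) - 1) div 6))"
proof -
  \<comment> \<open>Writing the power of 5 as 24t + 1 makes the divisions by 6 exact.\<close>
  define t where "t = (5::nat)^(2*\<alpha>) div 24"
  have t: "(5::nat)^(2*\<alpha>) = 24 * t + 1"
    using five_power_mod_24[of \<alpha>] unfolding t_def by presburger
  have t': "(5::nat)^(2*\<alpha>+1) = 120 * t + 5" "(5::nat)^(2*\<alpha>+2) = 600 * t + 25"
    using t by simp_all
  \<comment> \<open>After descent r = 2u^2 modulo 5, which is 0, 2 or 3.\<close>
  have no1: "2 * x^2 + 5 * y^2 \<noteq> 5^(2*\<alpha>) * r" if "r mod 5 = 1 \<or> r mod 5 = 4" for x y r :: nat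
  proof
    assume "2 * x^2 + 5 * y^2 = 5^(2*\<alpha>) * r"
    then obtain u v where "2 * u^2 + 5 * v^2 = r" by (rule reps_2_5_descent)
    then have "r mod 5 = 2 * (u^2 mod 5) mod 5"
      by (auto simp: mod_mult_right_eq)
    then show False using square_mod_5[of u] that by auto
  qed
  \<comment> \<open>One further factor 5 leads to r = v^2 modulo 5, which is 0, 1 or 4.\<close>
  have no2: "2 * x^2 + 5 * y^2 \<noteq> 5^(2*\<alpha>) * (5 * r)" if "r mod 5 = 2 \<or> r mod 5 = 3" for x y r :: nat
  proof
    assume "2 * x^2 + 5 * y^2 = 5^(2*\<alpha>) * (5 * r)"
    then obtain u v where "2 * u^2 + 5 * v^2 = 5 * r" by (rule reps_2_5_descent)
    then obtain z where "v^2 + 10 * z^2 = r" by (rule reps_2_5_descent_step)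
    then have "r mod 5 = (v^2 + 5 * (2 * z^2)) mod 5" by simp
    then have "r mod 5 = v^2 mod 5" by (simp only: mod_mult_self2)
    then show False using square_mod_5[of v] that by auto
  qed
  have res: "(120 * n + c) mod 5 = c mod 5" for c
    by presburger
  have mod4: "(4 * p * k + (4 * q + 1)) mod 4 = 1" for p k q :: nat
  proof -
    have "4 * p * k + (4 * q + 1) = 1 + 4 * (p * k + q)" by simp
    then show ?thesis by (simp only: mod_mult_self2) simp
  qed
  \<comment> \<open>Used for \<open>c = 31\<close> and \<open>c = 79\<close>: the residue 7 modulo
    24 makes the argument 1 modulo 4, and the residue modulo 5 rules out representations.\<close>
  have case1: "even (b 5 (4 * 5^(2*\<alpha>+1) * n + (c * 5^(2*\<alpha>) - 1) div 6))"
    if c: "c mod 24 = 7" "c mod 5 = 1 \<or> c mod 5 = 4" for c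
  proof (rule even_b_5_if_no_reps)
    define s where "s = c div 24"
    have s: "c = 24 * s + 7" using c(1) unfolding s_def by presburger
    have div: "(c * 5^(2*\<alpha>) - 1) div 6 = 4 * (24 * s * t + s + 7 * t) + 1"
      unfolding t s by (simp add: algebra_simps)
    then show "(4 * 5^(2*\<alpha>+1) * n + (c * 5^(2*\<alpha>) - 1) div 6) mod 4 = 1"
      by (simp only: mod4)
    have "6 * (4 * 5^(2*\<alpha>+1) * n + (c * 5^(2*\<alpha>) - 1) div 6) + 1 = 5^(2*\<alpha>) * (120 * n + c)"
      unfolding div t' unfolding t s by (simp add: algebra_simps)
    then show "2 * x^2 + 5 * y^2 \<noteq> 6 * (4 * 5^(2*\<alpha>+1) * n + (c * 5^(2*\<alpha>) - 1) div 6) + 1" for x y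
      using no1[of "120 * n + c"] c(2) res[of c] by (simp only: simp_thms)
  qed
  \<comment> \<open>Used for \<open>c = 83\<close> and \<open>c = 107\<close>; now the residue is
    11, since 5 * 11 is 7 modulo 24.\<close>
  have case2: "even (b 5 (4 * 5^(2*\<alpha>+2) * n + (c * 5^(2*\<alpha>+1) - 1) div 6))"
    if c: "c mod 24 = 11" "c mod 5 = 2 \<or> c mod 5 = 3" for c
  proof (rule even_b_5_if_no_reps)
    define s where "s = c div 24"
    have s: "c = 24 * s + 11" using c(1) unfolding s_def by presburger
    have div: "(c * 5^(2*\<alpha>+1) - 1) div 6 = 4 * (120 * s * t + 5 * s + 55 * t + 2) + 1"
      unfolding t' s by (simp add: algebra_simps)
    then show "(4 * 5^(2*\<alpha>+2) * n + (c * 5^(2*\<alpha>+1) - 1) div 6) mod 4 = 1"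
      by (simp only: mod4)
    have "6 * (4 * 5^(2*\<alpha>+2) * n + (c * 5^(2*\<alpha>+1) - 1) div 6) + 1 = 5^(2*\<alpha>) * (5 * (120 * n + c))"
      unfolding div t' unfolding t s by (simp add: algebra_simps)
    then show "2 * x^2 + 5 * y^2 \<noteq> 6 * (4 * 5^(2*\<alpha>+2) * n + (c * 5^(2*\<alpha>+1) - 1) div 6) + 1" for x y
      using no2[of "120 * n + c"] c(2) res[of c] by (simp only: simp_thms)
  qed
  show ?thesis
    by (intro conjI case1 case2) simp_all
qed

end
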